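(* For $\alpha=(\alpha_0,\alpha_1)\in\mathbb N^2$, $s>0$ and $m\in\{0,1,\dots,\alpha_1\}$, $$\mathfrak H_{\alpha}(s,m)=\frac{(-1)^{\alpha_1+m}}{\alpha!}\,s^{m-\alpha_1}\partial_s^{\alpha_0}s^{|\alpha|-m}\partial_s^{\alpha_1}\frac{s^m\log s}{s-1}=\frac{(-1)^{\alpha_1+m}}{\alpha!}\,\partial_s^{\alpha_1}s^m\partial_s^{\alpha_0}\frac{s^{\alpha_0}\log s}{s-1},$$ and for $m=0$ $$\mathfrak H_\alpha(s,0)=(-1)^{|\alpha|}[1^{\alpha_0+1},s^{\alpha_1+1}]\log=(-1)^{|\alpha|}[1^{\alpha_0},s^{\alpha_1+1}]\mathcal L_0=\frac{(-1)^{\alpha_1}}{\alpha!}\,\partial_s^{|\alpha|}\frac{s^{\alpha_0}\log s}{s-1}.$$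
   Context: For $\alpha=(\alpha_0,\alpha_1)$, $s>0$, $m$ integer with $0\le m\le|\alpha|$: $\mathfrak H_\alpha(s,m):=\int_0^\infty x^{|\alpha|-m}(1+x)^{-\alpha_0-1}(1+sx)^{-\alpha_1-1}\,dx$, where $|\alpha|=\alpha_0+\alpha_1$, $\alpha!=\alpha_0!\alpha_1!$. $\mathcal L_0(s):=[1,s]\log=\frac{\log s}{s-1}$ (value $1$ at $s=1$). Divided differences: for $f$ smooth on an open interval, $[y_0]f=f(y_0)$, $[y_0,\dots,y_n]f=\int_{\{t\ge0,\sum t_j=1\}}f^{(n)}(\sum t_jy_j)\,dt_1\cdots dt_n$ (defined also for repeated arguments); $[1^{k},s^{l}]f$ denotes the divided difference with $k$ arguments equal to $1$ and $l$ equal to $s$. Functions such as $\frac{s^m\log s}{s-1}$ are extended smoothly to $s=1$. *)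

theory Defs
  imports "HOL-Analysis.Analysis"
begin

definition frakH :: "nat \<Rightarrow> nat \<Rightarrow> real \<Rightarrow> nat \<Rightarrow> real" where
  "frakH a0 a1 s m =
     (\<integral>x\<in>{0<..}. x ^ (a0 + a1 - m) / ((1 + x) ^ (a0 + 1) * (1 + s * x) ^ (a1 + 1)) \<partial>lborel)"

definition Lm :: "nat \<Rightarrow> real \<Rightarrow> real" where
  "Lm m s = (if s = 1 then 1 else s ^ m * ln s / (s - 1))"

text \<open>L_0(s) = [1,s] log = log s / (s - 1), value 1 at s = 1.\<close>
definition L0 :: "real \<Rightarrow> real" where
  "L0 s = (if s = 1 then 1 else ln s / (s - 1))"

text \<open>Divided difference [y_0,...,y_n] f via the Hermite--Genocchi simplex integral:
  integral over {t_1..t_n >= 0, sum t_j <= 1} of f^(n)(t_0 y_0 + sum t_j y_j), t_0 = 1 - sum t_j.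
  Coordinates t_1..t_n are stored as t 0 .. t (n-1); the points are ys!0, ..., ys!n.\<close>
definition simplex_std :: "nat \<Rightarrow> (nat \<Rightarrow> real) set" where
  "simplex_std n = {t \<in> extensional {..<n}. (\<forall>j<n. 0 \<le> t j) \<and> (\<Sum>j<n. t j) \<le> 1}"

definition divdiff :: "real list \<Rightarrow> (real \<Rightarrow> real) \<Rightarrow> real" where
  "divdiff ys f =
     (let n = length ys - 1 in
      \<integral>t\<in>simplex_std n.
         (deriv ^^ n) f ((1 - (\<Sum>j<n. t j)) * ys ! 0 + (\<Sum>j<n. t j * ys ! (j + 1)))
       \<partial>(PiM {..<n} (\<lambda>_. lborel)))"

definition divdiff_1s :: "nat \<Rightarrow> real \<Rightarrow> nat \<Rightarrow> (real \<Rightarrow> real) \<Rightarrow> real" where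
  "divdiff_1s k s l f = divdiff (replicate k 1 @ replicate l s) f"

end

theory Submission
  imports Defs "HOL-Real_Asymp.Real_Asymp"
begin

text \<open>
  The substitution \<open>x = t / (1 - t)\<close> turns \<open>H_\<alpha>(s, m)\<close> into the Euler-type integral
  \<open>J(b, e, f)(s) = \<integral>\<^sub>0\<^sup>1 t^e (1 - t)^f / (1 + t (s - 1))^b dt\<close> with \<open>b = \<alpha>\<^sub>1 + 1\<close>.
  Differentiation in \<open>s\<close> raises \<open>b\<close> and \<open>e\<close>, multiplication by \<open>s\<close> is controlled by the
  contiguous relation \<open>J(b+1, E, F) - s J(b+2, E+1, F) = J(b+2, E, F+1)\<close>, and the substitution
  \<open>t \<mapsto> (1 - t) / (1 + t (s - 1))\<close> gives the reflection \<open>s^b J(b, e, f) = s^(f+1) J(e+f+2-b, f, e)\<close>.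
  Since \<open>s^m log s / (s - 1) = s^m J(1, 0, 0)(s)\<close>, the derivative formulas follow.
  For the divided differences, the Hermite--Genocchi integral of a function of the sum of the
  simplex coordinates attached to the nodes \<open>s\<close> collapses to a one-dimensional integral against
  the Beta density \<open>u^l (1 - u)^k / (l! k!)\<close>, which is again of the form \<open>J\<close>
  (for \<open>L\<^sub>0\<close> after one integration by parts).
\<close>

section \<open>Higher derivatives of smooth real functions\<close>

definition smooth_on :: "real set \<Rightarrow> (real \<Rightarrow> real) \<Rightarrow> bool" where
  "smooth_on S f \<longleftrightarrow> (\<forall>n. \<forall>x\<in>S. (deriv ^^ n) f field_differentiable (at x))"

lemma smooth_on_has_field_derivative:
  assumes "smooth_on S f" "x \<in> S"
  shows "((deriv ^^ n) f has_field_derivative deriv ((deriv ^^ n) f) x) (at x)"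
  using assms unfolding smooth_on_def by (simp add: field_differentiable_derivI)

lemma higher_deriv_cong_open:
  assumes "open S" "x \<in> S" "\<And>y. y \<in> S \<Longrightarrow> f y = g y"
  shows "(deriv ^^ k) f x = (deriv ^^ k) g x"
proof (rule higher_deriv_cong_ev)
  show "\<forall>\<^sub>F x in nhds x. f x = g x"
    using eventually_nhds_in_open[OF assms(1,2)] assms(3) by (rule eventually_mono)
qed simp

lemma higher_deriv_mult_real:
  fixes z :: real
  assumes "smooth_on S f" "smooth_on S g" "open S" and z: "z \<in> S"
  shows "(deriv ^^ n) (\<lambda>w. f w * g w) z =
           (\<Sum>i = 0..n. of_nat (n choose i) * (deriv ^^ i) f z * (deriv ^^ (n-i)) g z)"
  using z
proof (induction n arbitrary: z)
  case 0 then show ?case by simp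
next
  case (Suc n z)
  have Suc_choose: "\<And>n k. Suc n choose k = (n choose k) + (if k = 0 then 0 else (n choose (k-1)))"
    by (case_tac k) simp_all
  have *: "\<And>n. ((deriv ^^ n) f has_field_derivative deriv ((deriv ^^ n) f) z) (at z)"
          "\<And>n. ((deriv ^^ n) g has_field_derivative deriv ((deriv ^^ n) g) z) (at z)"
    using Suc.prems assms smooth_on_has_field_derivative by auto
  have sumeq: "(\<Sum>i = 0..n. of_nat (n choose i) * (deriv ((deriv ^^ i) f) z * (deriv ^^ (n-i)) g z
                  + deriv ((deriv ^^ (n-i)) g) z * (deriv ^^ i) f z)) =
            g z * deriv ((deriv ^^ n) f) z
              + (\<Sum>i = 0..n. (deriv ^^ i) f z * (of_nat (Suc n choose i) * (deriv ^^ (Suc n - i)) g z))"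
    apply (simp add: Suc_choose algebra_simps sum.distrib)
    apply (subst (4) sum_Suc_reindex)
    apply (auto simp: algebra_simps Suc_diff_le intro: sum.cong)
    done
  have "((deriv ^^ n) (\<lambda>w. f w * g w) has_field_derivative
         (\<Sum>i = 0..Suc n. (Suc n choose i) * (deriv ^^ i) f z * (deriv ^^ (Suc n - i)) g z)) (at z)"
    apply (rule has_field_derivative_transform_within_open
        [of "\<lambda>w. (\<Sum>i = 0..n. of_nat (n choose i) * (deriv ^^ i) f w * (deriv ^^ (n-i)) g w)" _ _ S])
       apply (simp add: algebra_simps)
       apply (rule derivative_eq_intros | simp)+
           apply (auto intro: DERIV_mult * \<open>open S\<close> Suc.prems Suc.IH [symmetric])
    by (metis (no_types, lifting) mult.commute sum.cong sumeq)
  then show ?case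
    unfolding funpow.simps o_apply by (simp add: DERIV_imp_deriv)
qed

lemma higher_deriv_cmult_power:
  "(deriv ^^ j) (\<lambda>x::real. c * x ^ p) = (\<lambda>x. c * real (\<Prod>i<j. p - i) * x ^ (p - j))"
proof (induction j)
  case 0 then show ?case by simp
next
  case (Suc j)
  show ?case
  proof (rule ext)
    fix x :: real
    have "((\<lambda>x. c * real (\<Prod>i<j. p - i) * x ^ (p - j)) has_real_derivative
            c * real (\<Prod>i<j. p - i) * (real (p - j) * x ^ (p - j - Suc 0))) (at x)"
      by (intro DERIV_cmult DERIV_pow)
    moreover have "c * real (\<Prod>i<j. p - i) * (real (p - j) * x ^ (p - j - Suc 0)) =
                   c * real (\<Prod>i<Suc j. p - i) * x ^ (p - Suc j)"
    proof -
      have "p - j - Suc 0 = p - Suc j" by simp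
      then show ?thesis by (simp only: prod.lessThan_Suc of_nat_mult)
    qed
    ultimately show "(deriv ^^ Suc j) (\<lambda>x. c * x ^ p) x = c * real (\<Prod>i<Suc j. p - i) * x ^ (p - Suc j)"
      by (simp add: Suc DERIV_imp_deriv)
  qed
qed

lemma smooth_on_cmult_power: "smooth_on S (\<lambda>x::real. c * x ^ p)"
  unfolding smooth_on_def higher_deriv_cmult_power by (auto intro!: derivative_intros)

lemma smooth_on_power: "smooth_on S (\<lambda>x::real. x ^ p)"
  using smooth_on_cmult_power[of S 1 p] by simp

lemma smooth_on_mult:
  assumes "smooth_on S f" "smooth_on S g" "open S"
  shows "smooth_on S (\<lambda>x. f x * g x)"
  unfolding smooth_on_def
proof (intro allI ballI)
  fix n x assume x: "x \<in> S"
  have "(\<lambda>y. \<Sum>i = 0..n. of_nat (n choose i) * (deriv ^^ i) f y * (deriv ^^ (n-i)) g y)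
          field_differentiable (at x)"
    using assms x unfolding smooth_on_def
    by (intro field_differentiable_sum field_differentiable_mult field_differentiable_const) auto
  then obtain D where D: "((\<lambda>y. \<Sum>i = 0..n. of_nat (n choose i) * (deriv ^^ i) f y * (deriv ^^ (n-i)) g y)
          has_field_derivative D) (at x)"
    unfolding field_differentiable_def by blast
  have "((deriv ^^ n) (\<lambda>x. f x * g x) has_field_derivative D) (at x)"
    by (rule has_field_derivative_transform_within_open[OF D assms(3) x])
       (simp add: higher_deriv_mult_real[OF assms(1,2,3)])
  then show "(deriv ^^ n) (\<lambda>x. f x * g x) field_differentiable (at x)"
    unfolding field_differentiable_def by blast
qed

lemma higher_deriv_cmult_real:
  assumes "smooth_on S f" "open S" "x \<in> S"
  shows "(deriv ^^ n) (\<lambda>x. c * f x) x = c * (deriv ^^ n) f x"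
proof -
  have "(deriv ^^ n) (\<lambda>x. c * f x) x =
          (\<Sum>i = 0..n. of_nat (n choose i) * (deriv ^^ i) (\<lambda>x. c * x ^ 0) x * (deriv ^^ (n-i)) f x)"
    using higher_deriv_mult_real[OF smooth_on_cmult_power[of S c 0] assms] by simp
  also have "\<dots> = (\<Sum>i \<in> {0}. of_nat (n choose i) * (deriv ^^ i) (\<lambda>x. c * x ^ 0) x * (deriv ^^ (n-i)) f x)"
  proof (rule sum.mono_neutral_right)
    show "\<forall>i\<in>{0..n} - {0}. of_nat (n choose i) * (deriv ^^ i) (\<lambda>x. c * x ^ 0) x * (deriv ^^ (n - i)) f x = 0"
      unfolding higher_deriv_cmult_power by (auto simp: prod_zero_iff)
  qed auto
  finally show ?thesis by simp
qed

lemma higher_deriv_id_mult: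
  assumes "smooth_on S g" "open S" "x \<in> S"
  shows "(deriv ^^ Suc b) (\<lambda>x. x * g x) x = x * (deriv ^^ Suc b) g x + real (Suc b) * (deriv ^^ b) g x"
proof -
  have "(deriv ^^ Suc b) (\<lambda>x. x * g x) x =
          (\<Sum>i = 0..Suc b. of_nat (Suc b choose i) * (deriv ^^ i) (\<lambda>x. 1 * x ^ 1) x * (deriv ^^ (Suc b-i)) g x)"
    using higher_deriv_mult_real[OF smooth_on_cmult_power[of S 1 1] assms] by (simp only: mult_1 power_one_right)
  also have "\<dots> = (\<Sum>i \<in> {0, 1}. of_nat (Suc b choose i) * (deriv ^^ i) (\<lambda>x. 1 * x ^ 1) x * (deriv ^^ (Suc b-i)) g x)"
  proof (rule sum.mono_neutral_right)
    have "(\<Prod>j<i. 1 - j) = (0::nat)" if "i \<in> {0..Suc b} - {0, 1}" for i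
      using that by (intro prod_zero) (auto intro!: bexI[of _ 1])
    then show "\<forall>i\<in>{0..Suc b} - {0, 1}. of_nat (Suc b choose i) * (deriv ^^ i) (\<lambda>x. 1 * x ^ 1) x * (deriv ^^ (Suc b - i)) g x = 0"
      unfolding higher_deriv_cmult_power by simp
  qed auto
  also have "\<dots> = x * (deriv ^^ Suc b) g x + real (Suc b) * (deriv ^^ b) g x"
    unfolding higher_deriv_cmult_power by simp
  finally show ?thesis .
qed

section \<open>An Euler-type integral\<close>

text \<open>Euler's integral representation of \<open>B(e+1, f+1) \<^sub>2F\<^sub>1(b, e+1; e+f+2; 1 - s)\<close>.\<close>

definition euler_int :: "nat \<Rightarrow> nat \<Rightarrow> nat \<Rightarrow> real \<Rightarrow> real" where
  "euler_int b e f s = integral {0..1} (\<lambda>t. t ^ e * (1 - t) ^ f / (1 + t * (s - 1)) ^ b)"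

lemma integral_cmult_real: "integral S (\<lambda>x. c * f x :: real) = c * integral S f"
  using integral_cmul[where c=c and f=f and S=S] by simp

lemma euler_denom_pos:
  assumes "(s::real) > 0" "t \<in> {0..1}"
  shows "1 + t * (s - 1) > 0"
proof -
  have "1 + t * (s - 1) = (1 - t) + t * s" by (simp add: algebra_simps)
  moreover have "(1 - t) + t * s > 0"
    using assms by (cases "t = 1") (auto intro: add_pos_nonneg)
  ultimately show ?thesis by simp
qed

lemma euler_int_integrable:
  fixes s :: real assumes "s > 0"
  shows "(\<lambda>t::real. t ^ e * (1 - t) ^ f / (1 + t * (s - 1)) ^ b) integrable_on {0..1}"
  by (intro integrable_continuous_interval continuous_intros) (use euler_denom_pos[OF assms] in fastforce)

lemma euler_int_nonneg:
  fixes s :: real assumes "s > 0"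
  shows "euler_int b e f s \<ge> 0"
  unfolding euler_int_def
proof (rule integral_nonneg[OF euler_int_integrable[OF assms]])
  fix t :: real assume "t \<in> {0..1}"
  then show "0 \<le> t ^ e * (1 - t) ^ f / (1 + t * (s - 1)) ^ b"
    using euler_denom_pos[OF assms] by (intro divide_nonneg_nonneg) (auto intro!: zero_le_power less_imp_le)
qed

lemma has_real_derivative_divide_denom_power:
  fixes t c :: real
  assumes "1 + t * (x - 1) \<noteq> 0"
  shows "((\<lambda>x. c / (1 + t * (x - 1)) ^ b) has_real_derivative
           - real b * (t * c / (1 + t * (x - 1)) ^ (b + 1))) (at x within S)"
proof (cases b)
  case 0 then show ?thesis by simp
next
  case (Suc k)
  define W where "W = 1 + t * (x - 1)"
  have W: "W \<noteq> 0" using assms by (simp add: W_def)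
  have d: "((\<lambda>x. c / (1 + t * (x - 1)) ^ b) has_real_derivative
           - (c * (real b * W ^ k * t)) / (W ^ b * W ^ b)) (at x within S)"
    unfolding W_def Suc by (rule derivative_eq_intros refl | use assms in simp)+
  have "W ^ b * W ^ b = W ^ k * W ^ (b + 1)" by (simp add: Suc flip: power_add)
  then have "- (c * (real b * W ^ k * t)) / (W ^ b * W ^ b) = - real b * (t * c / W ^ (b + 1))"
    using W by simp
  from d[unfolded this] show ?thesis unfolding W_def .
qed

lemma euler_int_has_real_derivative:
  assumes "s > 0"
  shows "(euler_int b e f has_real_derivative (- real b * euler_int (b + 1) (e + 1) f s)) (at s)"
proof -
  let ?g = "\<lambda>s t. - real b * (t ^ (e + 1) * (1 - t) ^ f / (1 + t * (s - 1)) ^ (b + 1))"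
  have "((\<lambda>s. integral (cbox 0 1) (\<lambda>t. t ^ e * (1 - t) ^ f / (1 + t * (s - 1)) ^ b))
          has_field_derivative integral (cbox 0 1) (?g s)) (at s within {0<..})"
  proof (rule leibniz_rule_field_derivative)
    fix x t :: real assume x: "x \<in> {0<..}" and t: "t \<in> cbox 0 1"
    have "1 + t * (x - 1) \<noteq> 0" using euler_denom_pos[of x t] x t by (auto simp: cbox_interval)
    from has_real_derivative_divide_denom_power[OF this, of "t ^ e * (1 - t) ^ f" b]
    show "((\<lambda>x. t ^ e * (1 - t) ^ f / (1 + t * (x - 1)) ^ b) has_field_derivative ?g x t) (at x within {0<..})"
      by (simp add: mult_ac)
  next
    fix x :: real assume x: "x \<in> {0<..}"
    show "(\<lambda>t. t ^ e * (1 - t) ^ f / (1 + t * (x - 1)) ^ b) integrable_on cbox 0 1"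
      using euler_int_integrable[of x] x by (simp add: cbox_interval)
  next
    show "continuous_on ({0<..} \<times> cbox 0 1) (\<lambda>(x, t). ?g x t)"
      unfolding case_prod_beta' by (intro continuous_intros) (use euler_denom_pos in \<open>fastforce simp: cbox_interval\<close>)+
  qed (use assms in auto)
  moreover have "integral (cbox 0 1) (?g s) = - real b * euler_int (b + 1) (e + 1) f s"
    unfolding euler_int_def cbox_interval by (simp only: integral_cmult_real)
  ultimately show ?thesis
    using assms by (simp add: cbox_interval at_within_open[of s "{0<..}"] euler_int_def[abs_def])
qed

lemma continuous_on_euler_int: "continuous_on {0<..} (euler_int b e f)"
proof (rule DERIV_continuous_on[of _ _ "\<lambda>s. - real b * euler_int (b + 1) (e + 1) f s"])
  fix x :: real assume "x \<in> {0<..}"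
  then show "(euler_int b e f has_real_derivative - real b * euler_int (b + 1) (e + 1) f x) (at x within {0<..})"
    using euler_int_has_real_derivative[of x b e f] by (auto intro: has_field_derivative_at_within)
qed

lemma higher_deriv_euler_int:
  assumes "s > 0"
  shows "(deriv ^^ k) (euler_int b e f) s = (-1) ^ k * pochhammer (real b) k * euler_int (b + k) (e + k) f s"
  using assms
proof (induction k arbitrary: s)
  case 0 then show ?case by simp
next
  case (Suc k)
  have "((\<lambda>s. (-1) ^ k * pochhammer (real b) k * euler_int (b + k) (e + k) f s) has_real_derivative
          (-1) ^ k * pochhammer (real b) k * (- real (b + k) * euler_int (b + k + 1) (e + k + 1) f s)) (at s)"
    by (intro DERIV_cmult euler_int_has_real_derivative Suc.prems)
  then have "((deriv ^^ k) (euler_int b e f) has_real_derivative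
          (-1) ^ k * pochhammer (real b) k * (- real (b + k) * euler_int (b + k + 1) (e + k + 1) f s)) (at s)"
    by (rule has_field_derivative_transform_within_open[where S="{0<..}"]) (use Suc in auto)
  then show ?case by (simp add: DERIV_imp_deriv pochhammer_rec' algebra_simps)
qed

lemma smooth_on_euler_int: "smooth_on {0<..} (euler_int b e f)"
  unfolding smooth_on_def
proof (intro allI ballI)
  fix n and x :: real assume x: "x \<in> {0<..}"
  have "((\<lambda>s. (-1) ^ n * pochhammer (real b) n * euler_int (b + n) (e + n) f s) has_real_derivative
          (-1) ^ n * pochhammer (real b) n * (- real (b + n) * euler_int (b + n + 1) (e + n + 1) f x)) (at x)"
    using x by (intro DERIV_cmult euler_int_has_real_derivative) auto
  then have "((deriv ^^ n) (euler_int b e f) has_real_derivative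
          (-1) ^ n * pochhammer (real b) n * (- real (b + n) * euler_int (b + n + 1) (e + n + 1) f x)) (at x)"
    by (rule has_field_derivative_transform_within_open[where S="{0<..}"])
       (use x higher_deriv_euler_int in auto)
  then show "(deriv ^^ n) (euler_int b e f) field_differentiable at x"
    unfolding field_differentiable_def by blast
qed

lemma euler_int_contiguous:
  assumes "s > 0"
  shows "euler_int (b + 1) e f s - s * euler_int (b + 2) (e + 1) f s = euler_int (b + 2) e (f + 1) s"
proof -
  have "(\<lambda>t. s * (t ^ (e + 1) * (1 - t) ^ f / (1 + t * (s - 1)) ^ (b + 2))) integrable_on {0..1}"
    by (intro integrable_continuous_interval continuous_intros) (use euler_denom_pos[OF assms] in fastforce)
  then have "euler_int (b + 1) e f s - s * euler_int (b + 2) (e + 1) f s =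
        integral {0..1} (\<lambda>t. t ^ e * (1 - t) ^ f / (1 + t * (s - 1)) ^ (b + 1) -
                              s * (t ^ (e + 1) * (1 - t) ^ f / (1 + t * (s - 1)) ^ (b + 2)))"
    unfolding euler_int_def integral_cmult_real[symmetric]
    by (rule integral_diff[symmetric, OF euler_int_integrable[OF assms]])
  also have "\<dots> = euler_int (b + 2) e (f + 1) s"
    unfolding euler_int_def
  proof (rule integral_cong)
    fix t :: real assume t: "t \<in> {0..1}"
    define W where "W = 1 + t * (s - 1)"
    define X where "X = t ^ e * (1 - t) ^ f"
    have "W > 0" using euler_denom_pos[OF assms t] by (simp add: W_def)
    then have "X / W ^ (b + 1) = W * X / W ^ (b + 2)" by (simp add: field_simps)
    then have "X / W ^ (b + 1) - s * (t * X / W ^ (b + 2)) = (W - s * t) * X / W ^ (b + 2)"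
      by (simp add: diff_divide_distrib algebra_simps)
    also have "W - s * t = 1 - t" by (simp add: W_def algebra_simps)
    finally show "t ^ e * (1 - t) ^ f / (1 + t * (s - 1)) ^ (b + 1) -
          s * (t ^ (e + 1) * (1 - t) ^ f / (1 + t * (s - 1)) ^ (b + 2)) =
          t ^ e * (1 - t) ^ (f + 1) / (1 + t * (s - 1)) ^ (b + 2)"
      by (simp add: W_def X_def mult_ac)
  qed
  finally show ?thesis .
qed

lemma euler_int_split:
  assumes "s > 0"
  shows "euler_int b (e + 1) f s + euler_int b e (f + 1) s = euler_int b e f s"
proof -
  have "euler_int b (e + 1) f s + euler_int b e (f + 1) s =
     integral {0..1} (\<lambda>t. t ^ (e + 1) * (1 - t) ^ f / (1 + t * (s - 1)) ^ b
                          + t ^ e * (1 - t) ^ (f + 1) / (1 + t * (s - 1)) ^ b)"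
    unfolding euler_int_def by (rule integral_add[symmetric]; rule euler_int_integrable[OF assms])
  also have "\<dots> = euler_int b e f s"
    unfolding euler_int_def
  proof (rule integral_cong)
    fix t :: real
    have "t ^ (e + 1) * (1 - t) ^ f + t ^ e * (1 - t) ^ (f + 1) = t ^ e * (1 - t) ^ f"
      by (simp add: algebra_simps)
    then show "t ^ (e + 1) * (1 - t) ^ f / (1 + t * (s - 1)) ^ b + t ^ e * (1 - t) ^ (f + 1) / (1 + t * (s - 1)) ^ b =
          t ^ e * (1 - t) ^ f / (1 + t * (s - 1)) ^ b"
      by (metis add_divide_distrib)
  qed
  finally show ?thesis .
qed

lemma euler_int_diagonal:
  assumes "s > 0"
  shows "euler_int (n + 2) n 0 s = 1 / (real (n + 1) * s ^ (n + 1))"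
proof -
  \<comment> \<open>\<open>(t / (1 + t (s - 1)))^(n+1) / (n+1)\<close> is a primitive, as \<open>t / (1 + t (s - 1))\<close> has derivative \<open>1 / (1 + t (s - 1))^2\<close>.\<close>
  have "((\<lambda>t. t ^ n * (1 - t) ^ 0 / (1 + t * (s - 1)) ^ (n + 2)) has_integral
          ((1 / (1 + 1 * (s - 1))) ^ (n + 1) / real (n + 1) - (0 / (1 + 0 * (s - 1))) ^ (n + 1) / real (n + 1))) {0..1}"
  proof (rule fundamental_theorem_of_calculus)
    fix t :: real assume t: "t \<in> {0..1}"
    define W where "W = 1 + t * (s - 1)"
    have W: "W > 0" using euler_denom_pos[OF assms t] by (simp add: W_def)
    have "((\<lambda>t. t / (1 + t * (s - 1))) has_real_derivative (1 * W - t * (s - 1)) / (W * W)) (at t within {0..1})"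
      unfolding W_def using W by (intro DERIV_divide derivative_eq_intros) (auto simp: W_def)
    moreover have "(1 * W - t * (s - 1)) / (W * W) = 1 / W ^ 2"
      by (simp add: W_def power2_eq_square)
    ultimately have "((\<lambda>t. t / (1 + t * (s - 1))) has_real_derivative 1 / W ^ 2) (at t within {0..1})"
      by simp
    from DERIV_cdivide[OF DERIV_power[OF this, of "n + 1"], of "real (n + 1)"]
    have "((\<lambda>t. (t / (1 + t * (s - 1))) ^ (n + 1) / real (n + 1)) has_real_derivative
         real (n + 1) * (t / W) ^ n * (1 / W ^ 2) / real (n + 1)) (at t within {0..1})"
      by (simp add: W_def)
    moreover have "real (n + 1) * (t / W) ^ n * (1 / W ^ 2) / real (n + 1) = t ^ n * (1 - t) ^ 0 / W ^ (n + 2)"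
      by (simp add: power_divide power_add power2_eq_square del: of_nat_Suc)
    ultimately show "((\<lambda>t. (t / (1 + t * (s - 1))) ^ (n + 1) / real (n + 1)) has_vector_derivative
            t ^ n * (1 - t) ^ 0 / (1 + t * (s - 1)) ^ (n + 2)) (at t within {0..1})"
      by (simp add: W_def has_real_derivative_iff_has_vector_derivative)
  qed simp
  then show ?thesis
    by (simp add: euler_int_def integral_unique power_divide)
qed

lemma euler_int_diagonal_step:
  assumes "s > 0"
  shows "(s - 1) * euler_int (n + 2) (n + 1) 0 s = euler_int (n + 1) n 0 s - 1 / (real (n + 1) * s ^ (n + 1))"
  using euler_int_contiguous[OF assms, of n n 0] euler_int_split[OF assms, of "n + 2" n 0]
        euler_int_diagonal[OF assms, of n]
  by (simp add: algebra_simps)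

lemma smooth_on_power_mult_euler_int: "smooth_on {0<..} (\<lambda>s. s ^ p * euler_int b e f s)"
  by (intro smooth_on_mult smooth_on_power smooth_on_euler_int) auto

lemma higher_deriv_power_mult_euler_int:
  assumes "p \<le> b" "s > 0"
  shows "(deriv ^^ b) (\<lambda>s. s ^ p * euler_int 1 e f s) s =
           (-1) ^ (b - p) * fact b * euler_int (b + 1) (e + b - p) (f + p) s"
  using assms
proof (induction p arbitrary: b)
  case 0
  then show ?case
    using higher_deriv_euler_int[OF 0(2), of b 1 e f] by (simp add: pochhammer_fact add.commute)
next
  case (Suc p)
  then obtain b' where b': "b = Suc b'" "p \<le> b'" by (cases b) auto
  have "(\<lambda>s. s ^ Suc p * euler_int 1 e f s) = (\<lambda>s. s * (s ^ p * euler_int 1 e f s))"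
    by (simp add: algebra_simps)
  then have "(deriv ^^ b) (\<lambda>s. s ^ Suc p * euler_int 1 e f s) s =
      s * (deriv ^^ Suc b') (\<lambda>s. s ^ p * euler_int 1 e f s) s
      + real (Suc b') * (deriv ^^ b') (\<lambda>s. s ^ p * euler_int 1 e f s) s"
    using higher_deriv_id_mult[OF smooth_on_power_mult_euler_int, of s b'] Suc.prems b' by simp
  also have "\<dots> = s * ((-1) ^ (Suc b' - p) * fact (Suc b') * euler_int (Suc b' + 1) (e + Suc b' - p) (f + p) s)
       + real (Suc b') * ((-1) ^ (b' - p) * fact b' * euler_int (b' + 1) (e + b' - p) (f + p) s)"
    using Suc.IH[of "Suc b'"] Suc.IH[of b'] b' Suc.prems by simp
  also have "\<dots> = (-1) ^ (b' - p) * fact (Suc b') *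
      (euler_int (b' + 1) (e + b' - p) (f + p) s - s * euler_int (b' + 2) (e + b' - p + 1) (f + p) s)"
    using b' by (simp add: Suc_diff_le algebra_simps)
  also have "\<dots> = (-1) ^ (b' - p) * fact (Suc b') * euler_int (b' + 2) (e + b' - p) (f + p + 1) s"
    by (simp only: euler_int_contiguous[OF Suc.prems(2)])
  finally show ?case using b' by simp
qed

lemma euler_reflection_integrand:
  fixes s u :: real
  assumes s: "s > 0" and u: "u \<in> {0..1}" and bk: "b + k = e + f + 2"
  defines "W \<equiv> 1 + u * (s - 1)"
  shows "s ^ b * (s / W ^ 2 * (((1 - u) / W) ^ e * (1 - (1 - u) / W) ^ f / (1 + (1 - u) / W * (s - 1)) ^ b))
           = s ^ (f + 1) * (u ^ f * (1 - u) ^ e / W ^ k)"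
proof -
  have W: "W > 0" using euler_denom_pos[OF s u] by (simp add: W_def)
  have one_minus: "1 - (1 - u) / W = s * u / W" using W by (simp add: field_simps W_def algebra_simps)
  have denom: "1 + (1 - u) / W * (s - 1) = s / W" using W by (simp add: field_simps W_def algebra_simps)
  have "s ^ b * (s / W ^ 2 * (((1 - u) / W) ^ e * (s * u / W) ^ f / (s / W) ^ b))
        = s ^ (f + 1) * (u ^ f * (1 - u) ^ e) * (W ^ b / (W ^ 2 * W ^ e * W ^ f))"
    using W s by (simp add: power_divide power_mult_distrib field_simps)
  also have "W ^ b / (W ^ 2 * W ^ e * W ^ f) = 1 / W ^ k"
  proof -
    have "W ^ 2 * W ^ e * W ^ f = W ^ b * W ^ k" using bk by (simp add: power_add[symmetric] add_ac)
    then show ?thesis using W by simp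
  qed
  finally show ?thesis unfolding one_minus denom by simp
qed

lemma euler_reflection_in_unit_interval:
  fixes s u :: real
  assumes s: "s > 0" and u: "u \<in> {0..1}"
  shows "(1 - u) / (1 + u * (s - 1)) \<in> {0..1}"
proof -
  have "1 + u * (s - 1) > 0" using euler_denom_pos[OF s u] .
  moreover have "1 - u \<le> 1 + u * (s - 1)" using u s by (simp add: algebra_simps)
  ultimately show ?thesis using u by (auto simp: pos_divide_le_eq)
qed

lemma euler_int_reflection:
  assumes s: "s > 0" and bk: "b \<le> e + f + 2"
  shows "euler_int b e f s = s ^ (f + 1) / s ^ b * euler_int (e + f + 2 - b) f e s"
proof -
  define k where "k = e + f + 2 - b"
  define F where "F = (\<lambda>t::real. t ^ e * (1 - t) ^ f / (1 + t * (s - 1)) ^ b)"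
  define g where "g = (\<lambda>u::real. (1 - u) / (1 + u * (s - 1)))"
  define g' where "g' = (\<lambda>u::real. - s / (1 + u * (s - 1)) ^ 2)"
  have Wp: "\<And>u. u \<in> {0..1} \<Longrightarrow> 1 + u * (s - 1) > 0" using euler_denom_pos[OF s] by auto
  have gmap: "g ` {0..1} \<subseteq> {0..1}"
    using euler_reflection_in_unit_interval[OF s] by (auto simp: g_def)
  have "((\<lambda>u. g' u *\<^sub>R F (g u)) has_integral (integral {g 0..g 1} F - integral {g 1..g 0} F)) {0..1}"
  proof (rule has_integral_substitution_general[of "{}" 0 1 g 0 1 F])
    show "continuous_on {0..1} F" unfolding F_def
      by (intro continuous_intros) (use Wp in fastforce)
    show "continuous_on {0..1} g" unfolding g_def
      by (intro continuous_intros) (use Wp in fastforce)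
  next
    fix u :: real assume u: "u \<in> {0..1} - {}"
    have W: "1 + u * (s - 1) \<noteq> 0" using Wp u by force
    show "(g has_real_derivative g' u) (at u within {0..1})"
      unfolding g_def g'_def
      apply (rule derivative_eq_intros refl)+
      using W by (auto simp: field_simps power2_eq_square)
  qed (use gmap in auto)
  moreover have "g 0 = 1" "g 1 = 0" using s by (auto simp: g_def)
  ultimately have I: "((\<lambda>u. g' u * F (g u)) has_integral (- euler_int b e f s)) {0..1}"
    by (simp add: euler_int_def F_def)
  have bk': "b + k = e + f + 2" using bk by (simp add: k_def)
  have pt: "s ^ b * (- (g' u * F (g u))) = s ^ (f + 1) * (u ^ f * (1 - u) ^ e / (1 + u * (s - 1)) ^ k)"
    if u: "u \<in> {0..1}" for u
  proof -
    have eq: "- (g' u * F (g u)) = s / (1 + u * (s - 1)) ^ 2 * (((1 - u) / (1 + u * (s - 1))) ^ e *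
            (1 - (1 - u) / (1 + u * (s - 1))) ^ f / (1 + (1 - u) / (1 + u * (s - 1)) * (s - 1)) ^ b)"
      by (simp add: g'_def F_def g_def)
    show ?thesis
      unfolding eq by (rule euler_reflection_integrand[OF s u bk'])
  qed
  have "((\<lambda>u. s ^ b * (- (g' u * F (g u)))) has_integral s ^ b * euler_int b e f s) {0..1}"
    using has_integral_mult_right[OF has_integral_neg[OF I], of "s ^ b"] by simp
  then have "((\<lambda>u. s ^ (f + 1) * (u ^ f * (1 - u) ^ e / (1 + u * (s - 1)) ^ k))
               has_integral s ^ b * euler_int b e f s) {0..1}"
    by (rule has_integral_eq[rotated]) (use pt in auto)
  then have "s ^ b * euler_int b e f s = s ^ (f + 1) * euler_int k f e s"
    unfolding euler_int_def integral_cmult_real[symmetric] by (rule integral_unique[symmetric])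
  then show ?thesis
    using s by (simp add: k_def field_simps)
qed

lemma euler_int_1_0_0:
  assumes s: "s > 0"
  shows "euler_int 1 0 0 s = L0 s"
proof (cases "s = 1")
  case True
  then show ?thesis by (simp add: euler_int_def L0_def)
next
  case False
  have "((\<lambda>t. 1 / (1 + t * (s - 1))) has_integral
          (ln (1 + 1 * (s - 1)) / (s - 1) - ln (1 + 0 * (s - 1)) / (s - 1))) {0..1}"
  proof (rule fundamental_theorem_of_calculus)
    fix t :: real assume t: "t \<in> {0..1}"
    have W: "1 + t * (s - 1) > 0" using euler_denom_pos[OF s t] .
    have "((\<lambda>t. ln (1 + t * (s - 1)) / (s - 1)) has_real_derivative 1 / (1 + t * (s - 1)) * (s - 1) / (s - 1))
            (at t within {0..1})"
      using W by (intro DERIV_cdivide DERIV_chain2[OF DERIV_ln_divide]) (auto intro!: derivative_eq_intros)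
    then show "((\<lambda>t. ln (1 + t * (s - 1)) / (s - 1)) has_vector_derivative 1 / (1 + t * (s - 1))) (at t within {0..1})"
      using False by (simp add: has_real_derivative_iff_has_vector_derivative)
  qed simp
  then show ?thesis
    using False unfolding euler_int_def L0_def by (simp add: integral_unique)
qed

section \<open>Derivative formulas\<close>

lemma Lm_eq_power_mult_euler_int: "s > 0 \<Longrightarrow> Lm m s = s ^ m * euler_int 1 0 0 s"
  by (subst euler_int_1_0_0) (auto simp: Lm_def L0_def)

lemma higher_deriv_Lm:
  assumes "s > 0" "m \<le> b"
  shows "(deriv ^^ b) (Lm m) s = (-1) ^ (b - m) * fact b * euler_int (b + 1) (b - m) m s"
proof -
  have "(deriv ^^ b) (Lm m) s = (deriv ^^ b) (\<lambda>s. s ^ m * euler_int 1 0 0 s) s"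
    by (rule higher_deriv_cong_open[of "{0<..}"]) (use assms Lm_eq_power_mult_euler_int in auto)
  also have "\<dots> = (-1) ^ (b - m) * fact b * euler_int (b + 1) (b - m) m s"
    using higher_deriv_power_mult_euler_int[OF assms(2,1), of 0 0] by simp
  finally show ?thesis .
qed

lemma frakH_integrand_substitution:
  fixes s t :: real
  assumes s: "s > 0" and t: "0 < t" "t < 1" and m: "m \<le> a0 + a1"
  shows "(t / (1 - t)) ^ (a0 + a1 - m) / ((1 + t / (1 - t)) ^ (a0 + 1) * (1 + s * (t / (1 - t))) ^ (a1 + 1))
           * (1 / (1 - t) ^ 2)
         = t ^ (a0 + a1 - m) * (1 - t) ^ m / (1 + t * (s - 1)) ^ (a1 + 1)"
proof -
  define E where "E = a0 + a1 - m"
  have t1: "1 - t > 0" using t by simp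
  have W: "1 + t * (s - 1) > 0" using euler_denom_pos[OF s] t by simp
  have "1 + t / (1 - t) = 1 / (1 - t)" using t1 by (simp add: field_simps)
  moreover have "1 + s * (t / (1 - t)) = (1 + t * (s - 1)) / (1 - t)" using t1 by (simp add: field_simps)
  ultimately have "(t / (1 - t)) ^ E / ((1 + t / (1 - t)) ^ (a0 + 1) * (1 + s * (t / (1 - t))) ^ (a1 + 1))
           * (1 / (1 - t) ^ 2)
      = t ^ E * (1 - t) ^ (a0 + 1) * (1 - t) ^ (a1 + 1) / ((1 - t) ^ E * (1 - t) ^ 2 * (1 + t * (s - 1)) ^ (a1 + 1))"
    using t1 W by (simp add: power_divide field_simps)
  also have "\<dots> = (t ^ E * (1 - t) ^ m) * ((1 - t) ^ E * (1 - t) ^ 2) /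
                     (((1 - t) ^ E * (1 - t) ^ 2) * (1 + t * (s - 1)) ^ (a1 + 1))"
  proof -
    have "(1 - t) ^ (a0 + 1) * (1 - t) ^ (a1 + 1) = (1 - t) ^ m * ((1 - t) ^ E * (1 - t) ^ 2)"
      using m by (simp add: E_def flip: power_add)
    then show ?thesis by (simp only: mult.assoc mult.left_commute[of "(1 - t) ^ E"])
  qed
  also have "\<dots> = t ^ E * (1 - t) ^ m / (1 + t * (s - 1)) ^ (a1 + 1)"
    using t1 by (intro nonzero_mult_divide_mult_cancel_right2) simp
  finally show ?thesis by (simp add: E_def)
qed

lemma frakH_eq_euler_int:
  assumes s: "s > 0" and m: "m \<le> a0 + a1"
  shows "frakH a0 a1 s m = euler_int (a1 + 1) (a0 + a1 - m) m s"
proof -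
  define F where "F = (\<lambda>x::real. x ^ (a0 + a1 - m) / ((1 + x) ^ (a0 + 1) * (1 + s * x) ^ (a1 + 1)))"
  define G where "G = (\<lambda>t::real. t ^ (a0 + a1 - m) * (1 - t) ^ m / (1 + t * (s - 1)) ^ (a1 + 1))"
  define g where "g = (\<lambda>t::real. t / (1 - t))"
  define g' where "g' = (\<lambda>t::real. 1 / (1 - t) ^ 2)"
  have pt: "F (g t) * g' t = G t" if "0 < t" "t < 1" for t
    unfolding F_def G_def g_def g'_def by (rule frakH_integrand_substitution[OF s that m])
  have intG: "set_integrable lborel {0..1} G"
    unfolding G_def by (intro borel_integrable_atLeastAtMost' continuous_intros)
       (use euler_denom_pos[OF s] in fastforce)
  have "frakH a0 a1 s m = (LBINT x=0..\<infinity>. F x)"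
    by (simp add: frakH_def F_def interval_lebesgue_integral_le_eq zero_ereal_def)
  also have "\<dots> = (LBINT x=0..1. F (g x) * g' x)"
  proof (rule interval_integral_substitution_nonneg(2)[of 0 1 g g' F 0 \<infinity>])
    fix x :: real assume "0 < ereal x" "ereal x < 1"
    then have x: "0 < x" "x < 1" by (auto simp: zero_ereal_def one_ereal_def)
    show "(g has_real_derivative g' x) (at x)" unfolding g_def g'_def
      apply (rule derivative_eq_intros refl)+
      using x by (auto simp: field_simps power2_eq_square)
    have "g x \<ge> 0" using x by (simp add: g_def)
    moreover have "1 + s * g x > 0" using \<open>g x \<ge> 0\<close> s by (simp add: add_pos_nonneg)
    ultimately show "isCont F (g x)" unfolding F_def by (intro continuous_intros) auto
    show "isCont g' x" unfolding g'_def using x by (intro continuous_intros) auto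
    show "0 \<le> F (g x)" using \<open>g x \<ge> 0\<close> s unfolding F_def by simp
  next
    fix x :: real assume "0 \<le> ereal x" "ereal x \<le> 1"
    show "0 \<le> g' x" by (simp add: g'_def)
  next
    show "set_integrable lborel (einterval 0 1) (\<lambda>x. F (g x) * g' x)"
      by (rule set_integrable_cong[THEN iffD1, rotated -1, OF set_integrable_subset[OF intG]])
         (auto simp: einterval_def pt)
    show "((ereal \<circ> g \<circ> real_of_ereal) \<longlongrightarrow> 0) (at_right 0)"
      unfolding zero_ereal_def ereal_tendsto_simps g_def by real_asymp
    show "((ereal \<circ> g \<circ> real_of_ereal) \<longlongrightarrow> \<infinity>) (at_left 1)"
      unfolding one_ereal_def ereal_tendsto_simps g_def by real_asymp
  qed simp
  also have "\<dots> = (LBINT x=0..1. G x)"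
    by (rule interval_integral_cong) (auto simp: einterval_def pt)
  also have "\<dots> = integral {0..1} G"
    using interval_integral_eq_integral[of 0 1 G] intG by (simp add: zero_ereal_def one_ereal_def)
  finally show ?thesis
    by (simp add: euler_int_def G_def)
qed

lemma neg_one_power_diff: "m \<le> n \<Longrightarrow> (-1::'a::ring_1) ^ (n - m) = (-1) ^ (n + m)"
proof -
  assume "m \<le> n"
  then have "n + m = (n - m) + 2 * m" by simp
  then have "(-1::'a) ^ (n + m) = (-1) ^ (n - m) * ((-1) ^ 2) ^ m" by (simp only: power_add power_mult)
  then show ?thesis by simp
qed

lemma frakH_eq_higher_deriv_Lm_m:
  assumes s: "s > 0" and m: "m \<le> a1"
  shows "frakH a0 a1 s m = (-1) ^ (a1 + m) / (fact a0 * fact a1) * (1 / s ^ (a1 - m)) *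
              (deriv ^^ a0) (\<lambda>t. t ^ (a0 + a1 - m) * (deriv ^^ a1) (Lm m) t) s"
proof -
  define c :: real where "c = (-1) ^ (a1 + m) * fact a1"
  have "t ^ (a0 + a1 - m) * (deriv ^^ a1) (Lm m) t = c * (t ^ a0 * euler_int 1 m (a1 - m) t)"
    if t: "t > 0" for t :: real
  proof -
    have "(deriv ^^ a1) (Lm m) t = c * euler_int (a1 + 1) (a1 - m) m t"
      using higher_deriv_Lm[OF t m] m by (simp add: c_def neg_one_power_diff)
    moreover have "euler_int (a1 + 1) (a1 - m) m t = t ^ (m + 1) / t ^ (a1 + 1) * euler_int 1 m (a1 - m) t"
      using euler_int_reflection[OF t, of "a1 + 1" "a1 - m" m] m by simp
    moreover have "t ^ (a0 + a1 - m) * (t ^ (m + 1) / t ^ (a1 + 1)) = t ^ a0"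
    proof -
      have "t ^ (a0 + a1 - m) * t ^ (m + 1) = t ^ a0 * t ^ (a1 + 1)"
        using m by (simp flip: power_add)
      then show ?thesis using t by (simp add: field_simps)
    qed
    ultimately show ?thesis by (simp add: mult_ac)
  qed
  then have "(deriv ^^ a0) (\<lambda>t. t ^ (a0 + a1 - m) * (deriv ^^ a1) (Lm m) t) s =
        (deriv ^^ a0) (\<lambda>t. c * (t ^ a0 * euler_int 1 m (a1 - m) t)) s"
    by (intro higher_deriv_cong_open[of "{0<..}"]) (use s in auto)
  also have "\<dots> = c * (deriv ^^ a0) (\<lambda>t. t ^ a0 * euler_int 1 m (a1 - m) t) s"
    by (rule higher_deriv_cmult_real[OF smooth_on_power_mult_euler_int]) (use s in auto)
  also have "\<dots> = c * (fact a0 * euler_int (a0 + 1) m (a0 + a1 - m) s)"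
    using higher_deriv_power_mult_euler_int[OF order.refl s, of a0 m "a1 - m"] m by (simp add: add.commute)
  also have "euler_int (a0 + 1) m (a0 + a1 - m) s = s ^ (a1 - m) * euler_int (a1 + 1) (a0 + a1 - m) m s"
  proof -
    have "a0 + a1 - m + 1 = (a1 - m) + (a0 + 1)" using m by simp
    then have "s ^ (a0 + a1 - m + 1) = s ^ (a1 - m) * s ^ (a0 + 1)" by (simp only: power_add)
    then show ?thesis
      using euler_int_reflection[OF s, of "a0 + 1" m "a0 + a1 - m"] m s by simp
  qed
  finally show ?thesis
    using s m by (simp add: frakH_eq_euler_int c_def field_simps flip: power_add)
qed

lemma frakH_eq_higher_deriv_Lm_a0:
  assumes s: "s > 0" and m: "m \<le> a1"
  shows "frakH a0 a1 s m = (-1) ^ (a1 + m) / (fact a0 * fact a1) *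
              (deriv ^^ a1) (\<lambda>t. t ^ m * (deriv ^^ a0) (Lm a0) t) s"
proof -
  have "t ^ m * (deriv ^^ a0) (Lm a0) t = fact a0 * (t ^ m * euler_int 1 a0 0 t)" if t: "t > 0" for t :: real
    using higher_deriv_Lm[OF t, of a0 a0] euler_int_reflection[OF t, of "a0 + 1" 0 a0] t by simp
  then have "(deriv ^^ a1) (\<lambda>t. t ^ m * (deriv ^^ a0) (Lm a0) t) s =
        (deriv ^^ a1) (\<lambda>t. fact a0 * (t ^ m * euler_int 1 a0 0 t)) s"
    by (intro higher_deriv_cong_open[of "{0<..}"]) (use s in auto)
  also have "\<dots> = fact a0 * (deriv ^^ a1) (\<lambda>t. t ^ m * euler_int 1 a0 0 t) s"
    by (rule higher_deriv_cmult_real[OF smooth_on_power_mult_euler_int]) (use s in auto)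
  also have "\<dots> = fact a0 * ((-1) ^ (a1 + m) * fact a1 * euler_int (a1 + 1) (a0 + a1 - m) m s)"
    using higher_deriv_power_mult_euler_int[OF m s, of a0 0] m by (simp add: neg_one_power_diff add.commute)
  finally show ?thesis
    using s m by (simp add: frakH_eq_euler_int field_simps flip: power_add)
qed

lemma frakH_0_eq_higher_deriv:
  assumes "s > 0"
  shows "frakH a0 a1 s 0 = (-1) ^ a1 / (fact a0 * fact a1) * (deriv ^^ (a0 + a1)) (Lm a0) s"
proof -
  have "(deriv ^^ (a0 + a1)) (Lm a0) = (deriv ^^ a1) ((deriv ^^ a0) (Lm a0))"
    by (metis add.commute funpow_add comp_apply)
  then show ?thesis
    using frakH_eq_higher_deriv_Lm_a0[OF assms, of 0 a1 a0] by simp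
qed

lemma frakH_0_eq_euler_int:
  assumes "s > 0"
  shows "frakH a0 a1 s 0 = fact (a0 + a1) / (fact a0 * fact a1) * euler_int (a0 + a1 + 1) a1 a0 s"
  using frakH_0_eq_higher_deriv[OF assms, of a0 a1] higher_deriv_Lm[OF assms, of a0 "a0 + a1"]
  by (simp flip: power_add)

section \<open>Integrals over the standard simplex\<close>

abbreviation Pi_lborel :: "nat set \<Rightarrow> (nat \<Rightarrow> real) measure" where
  "Pi_lborel I \<equiv> PiM I (\<lambda>_. lborel)"

definition orthant_indicator :: "nat set \<Rightarrow> (nat \<Rightarrow> real) \<Rightarrow> ennreal" where
  "orthant_indicator I t = (\<Prod>i\<in>I. indicator {0..} (t i))"

lemma orthant_indicator_measurable [measurable]:
  "finite I \<Longrightarrow> orthant_indicator I \<in> borel_measurable (Pi_lborel I)"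
  unfolding orthant_indicator_def by measurable

lemma orthant_indicator_insert:
  assumes "finite I" "i \<notin> I"
  shows "orthant_indicator (insert i I) (x(i := y)) = indicator {0..} y * orthant_indicator I x"
proof -
  have "(\<Prod>j\<in>I. indicator {0..} ((x(i := y)) j)) = orthant_indicator I x"
    unfolding orthant_indicator_def using assms by (intro prod.cong) auto
  then show ?thesis
    unfolding orthant_indicator_def using assms by simp
qed

lemma orthant_indicator_merge:
  assumes "A \<inter> B = {}" "finite A" "finite B"
  shows "orthant_indicator (A \<union> B) (merge A B (x, y)) = orthant_indicator A x * orthant_indicator B y"
proof -
  have "orthant_indicator (A \<union> B) (merge A B (x, y)) =
          (\<Prod>i\<in>A. indicator {0..} (merge A B (x, y) i)) * (\<Prod>i\<in>B. indicator {0..} (merge A B (x, y) i))"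
    unfolding orthant_indicator_def using assms by (simp add: prod.union_disjoint)
  also have "\<dots> = orthant_indicator A x * orthant_indicator B y"
    unfolding orthant_indicator_def using assms by (intro arg_cong2[where f="(*)"] prod.cong) auto
  finally show ?thesis .
qed

lemma sum_fun_upd_insert:
  assumes "finite I" "i \<notin> I"
  shows "(\<Sum>j\<in>insert i I. (x(i := y)) j) = y + (\<Sum>j\<in>I. x j :: real)"
proof -
  have "(\<Sum>j\<in>I. (x(i := y)) j) = (\<Sum>j\<in>I. x j)"
    using assms by (intro sum.cong) auto
  then show ?thesis using assms by simp
qed

lemma sum_merge:
  assumes "A \<inter> B = {}" "finite A" "finite B"
  shows "(\<Sum>i\<in>A \<union> B. merge A B (x, y) i) = (\<Sum>i\<in>A. x i) + (\<Sum>i\<in>B. y i :: real)"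
proof -
  have "(\<Sum>i\<in>A \<union> B. merge A B (x, y) i) = (\<Sum>i\<in>A. merge A B (x, y) i) + (\<Sum>i\<in>B. merge A B (x, y) i)"
    using assms by (simp add: sum.union_disjoint)
  also have "\<dots> = (\<Sum>i\<in>A. x i) + (\<Sum>i\<in>B. y i)"
    using assms by (intro arg_cong2[where f="(+)"] sum.cong) auto
  finally show ?thesis .
qed

lemma power_fact_has_integral:
  assumes "(v::real) \<ge> 0"
  shows "((\<lambda>u::real. u ^ n / fact n) has_integral (v ^ Suc n / fact (Suc n))) {0..v}"
proof -
  have "((\<lambda>u::real. u ^ n / fact n) has_integral (v ^ Suc n / fact (Suc n) - 0 ^ Suc n / fact (Suc n))) {0..v}"
  proof (rule fundamental_theorem_of_calculus)
    fix x :: real assume "x \<in> {0..v}"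
    have "((\<lambda>u::real. u ^ Suc n / fact (Suc n)) has_real_derivative (real (Suc n) * x ^ n / fact (Suc n)))
            (at x within {0..v})"
      using DERIV_cdivide[OF DERIV_pow[of "Suc n" x "{0..v}"], of "fact (Suc n)"] by simp
    moreover have "real (Suc n) * x ^ n / fact (Suc n) = x ^ n / fact n"
      by (simp add: fact_Suc del: of_nat_Suc)
    ultimately show "((\<lambda>u::real. u ^ Suc n / fact (Suc n)) has_vector_derivative x ^ n / fact n) (at x within {0..v})"
      by (simp add: has_real_derivative_iff_has_vector_derivative)
  qed (use assms in simp)
  then show ?thesis by simp
qed

lemma nn_integral_power_fact_interval:
  assumes "v \<ge> 0"
  shows "(\<integral>\<^sup>+u. indicator {0..v} u * ennreal (u ^ n / fact n) \<partial>lborel) = ennreal (v ^ Suc n / fact (Suc n))"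
  using nn_integral_has_integral_lebesgue[OF _ power_fact_has_integral[OF assms, of n]]
  by (simp add: indicator_mult_ennreal mult_ac)

lemma nn_integral_lborel_shift:
  fixes h :: "real \<Rightarrow> ennreal"
  assumes [measurable]: "h \<in> borel_measurable borel"
  shows "(\<integral>\<^sup>+y. indicator {0..} y * h (y + u) \<partial>lborel) = (\<integral>\<^sup>+v. indicator {0..} (v - u) * h v \<partial>lborel)"
proof -
  have "(\<integral>\<^sup>+v. indicator {0..} (v - u) * h v \<partial>lborel)
          = ennreal \<bar>1\<bar> * (\<integral>\<^sup>+x. indicator {0..} (u + 1 * x - u) * h (u + 1 * x) \<partial>lborel)"
    by (rule nn_integral_real_affine) auto
  then show ?thesis by (simp add: indicator_def add.commute)
qed

lemma nn_integral_orthant_convolution: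
  fixes h :: "real \<Rightarrow> ennreal"
  assumes [measurable]: "h \<in> borel_measurable borel"
  shows "(\<integral>\<^sup>+y. indicator {0..} y * (\<integral>\<^sup>+u. indicator {0..} u * h (y + u) * ennreal (u ^ c / fact c) \<partial>lborel) \<partial>lborel)
       = (\<integral>\<^sup>+v. indicator {0..} v * h v * ennreal (v ^ Suc c / fact (Suc c)) \<partial>lborel)"
proof -
  define w where "w = (\<lambda>u::real. ennreal (u ^ c / fact c))"
  have [measurable]: "w \<in> borel_measurable borel" unfolding w_def by measurable
  have "(\<integral>\<^sup>+y. indicator {0..} y * (\<integral>\<^sup>+u. indicator {0..} u * h (y + u) * w u \<partial>lborel) \<partial>lborel) =
        (\<integral>\<^sup>+y. \<integral>\<^sup>+u. indicator {0..} y * (indicator {0..} u * h (y + u) * w u) \<partial>lborel \<partial>lborel)"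
    by (intro nn_integral_cong nn_integral_cmult[symmetric]) measurable
  also have "\<dots> = (\<integral>\<^sup>+u. \<integral>\<^sup>+y. indicator {0..} y * (indicator {0..} u * h (y + u) * w u) \<partial>lborel \<partial>lborel)"
    by (rule lborel_pair.Fubini'[symmetric]) measurable
  also have "\<dots> = (\<integral>\<^sup>+u. (indicator {0..} u * w u) * (\<integral>\<^sup>+y. indicator {0..} y * h (y + u) \<partial>lborel) \<partial>lborel)"
    by (intro nn_integral_cong) (subst nn_integral_cmult[symmetric], measurable, simp add: mult_ac)
  also have "\<dots> = (\<integral>\<^sup>+u. (indicator {0..} u * w u) * (\<integral>\<^sup>+v. indicator {0..} (v - u) * h v \<partial>lborel) \<partial>lborel)"
    by (simp add: nn_integral_lborel_shift)
  also have "\<dots> = (\<integral>\<^sup>+u. \<integral>\<^sup>+v. (indicator {0..} u * w u) * (indicator {0..} (v - u) * h v) \<partial>lborel \<partial>lborel)"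
    by (intro nn_integral_cong nn_integral_cmult[symmetric]) measurable
  also have "\<dots> = (\<integral>\<^sup>+v. \<integral>\<^sup>+u. (indicator {0..} u * w u) * (indicator {0..} (v - u) * h v) \<partial>lborel \<partial>lborel)"
    by (rule lborel_pair.Fubini') measurable
  also have "\<dots> = (\<integral>\<^sup>+v. h v * (\<integral>\<^sup>+u. indicator {0..v} u * w u \<partial>lborel) \<partial>lborel)"
  proof (rule nn_integral_cong)
    fix v :: real
    have "(\<integral>\<^sup>+u. (indicator {0..} u * w u) * (indicator {0..} (v - u) * h v) \<partial>lborel) =
          (\<integral>\<^sup>+u. h v * (indicator {0..v} u * w u) \<partial>lborel)"
      by (intro nn_integral_cong) (auto simp: indicator_def mult_ac)
    also have "\<dots> = h v * (\<integral>\<^sup>+u. indicator {0..v} u * w u \<partial>lborel)"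
      by (rule nn_integral_cmult) measurable
    finally show "(\<integral>\<^sup>+u. (indicator {0..} u * w u) * (indicator {0..} (v - u) * h v) \<partial>lborel) =
          h v * (\<integral>\<^sup>+u. indicator {0..v} u * w u \<partial>lborel)" .
  qed
  also have "\<dots> = (\<integral>\<^sup>+v. indicator {0..} v * h v * ennreal (v ^ Suc c / fact (Suc c)) \<partial>lborel)"
  proof (rule nn_integral_cong)
    fix v :: real
    show "h v * (\<integral>\<^sup>+u. indicator {0..v} u * w u \<partial>lborel) = indicator {0..} v * h v * ennreal (v ^ Suc c / fact (Suc c))"
    proof (cases "v \<ge> 0")
      case True
      then show ?thesis unfolding w_def by (simp add: nn_integral_power_fact_interval)
    next
      case False
      then have "\<And>u. indicator {0..v} u * w u = 0" by (auto simp: indicator_def)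
      then show ?thesis using False by simp
    qed
  qed
  finally show ?thesis by (simp add: w_def)
qed

lemma nn_integral_orthant_sum:
  fixes h :: "real \<Rightarrow> ennreal"
  assumes "finite I" and "h \<in> borel_measurable borel"
  shows "(\<integral>\<^sup>+t. orthant_indicator I t * h (\<Sum>i\<in>I. t i) \<partial>Pi_lborel I) =
    (if I = {} then h 0
     else \<integral>\<^sup>+u. indicator {0..} u * h u * ennreal (u ^ (card I - 1) / fact (card I - 1)) \<partial>lborel)"
  using assms
proof (induction I arbitrary: h rule: finite_induct)
  case empty
  then show ?case by (simp add: PiM_empty orthant_indicator_def nn_integral_count_space_finite)
next
  case (insert i I)
  note [measurable] = insert.prems
  interpret product_sigma_finite "\<lambda>_. lborel :: real measure" by standard
  have "(\<integral>\<^sup>+t. orthant_indicator (insert i I) t * h (\<Sum>j\<in>insert i I. t j) \<partial>Pi_lborel (insert i I)) =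
     (\<integral>\<^sup>+y. \<integral>\<^sup>+x. orthant_indicator (insert i I) (x(i := y)) * h (\<Sum>j\<in>insert i I. (x(i := y)) j)
        \<partial>Pi_lborel I \<partial>lborel)"
    using insert.hyps(1)
    by (intro product_nn_integral_insert_rev[OF insert.hyps(1,2)] borel_measurable_times_ennreal
          orthant_indicator_measurable measurable_compose[OF _ insert.prems]) auto
  also have "\<dots> = (\<integral>\<^sup>+y. indicator {0..} y * (\<integral>\<^sup>+x. orthant_indicator I x * h (y + (\<Sum>j\<in>I. x j)) \<partial>Pi_lborel I) \<partial>lborel)"
    unfolding orthant_indicator_insert[OF insert.hyps(1,2)] sum_fun_upd_insert[OF insert.hyps(1,2)]
    by (intro nn_integral_cong)
       (subst nn_integral_cmult[symmetric], use insert.hyps(1) in measurable, simp add: mult_ac)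
  also have "\<dots> = (\<integral>\<^sup>+y. indicator {0..} y * (if I = {} then h (y + 0) else
       \<integral>\<^sup>+u. indicator {0..} u * h (y + u) * ennreal (u ^ (card I - 1) / fact (card I - 1)) \<partial>lborel) \<partial>lborel)"
    by (intro nn_integral_cong arg_cong2[where f="(*)"] refl insert.IH) measurable
  also have "\<dots> = \<integral>\<^sup>+u. indicator {0..} u * h u * ennreal (u ^ (card (insert i I) - 1) / fact (card (insert i I) - 1)) \<partial>lborel"
  proof (cases "I = {}")
    case True
    then show ?thesis by (simp add: mult_ac)
  next
    case False
    then have "card (insert i I) - 1 = Suc (card I - 1)"
      using insert.hyps by (simp add: card_gt_0_iff)
    then show ?thesis
      using False nn_integral_orthant_convolution[of h "card I - 1"] by simp
  qed
  finally show ?case using insert.hyps by simp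
qed

lemma nn_integral_orthant_truncation:
  fixes g :: "real \<Rightarrow> ennreal"
  assumes [measurable]: "g \<in> borel_measurable borel"
  shows "(\<integral>\<^sup>+w. indicator {0..} w * (\<integral>\<^sup>+u. indicator {0..} u * indicator {..1} (w + u) * g u \<partial>lborel)
              * ennreal (w ^ c / fact c) \<partial>lborel)
       = (\<integral>\<^sup>+u. indicator {0..1} u * g u * ennreal ((1 - u) ^ Suc c / fact (Suc c)) \<partial>lborel)"
proof -
  define w where "w = (\<lambda>u::real. ennreal (u ^ c / fact c))"
  have [measurable]: "w \<in> borel_measurable borel" unfolding w_def by measurable
  have "(\<integral>\<^sup>+x. indicator {0..} x * (\<integral>\<^sup>+u. indicator {0..} u * indicator {..1} (x + u) * g u \<partial>lborel) * w x \<partial>lborel) =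
        (\<integral>\<^sup>+x. \<integral>\<^sup>+u. (indicator {0..} x * w x) * (indicator {0..} u * indicator {..1} (x + u) * g u) \<partial>lborel \<partial>lborel)"
    by (intro nn_integral_cong) (subst nn_integral_cmult, measurable, simp add: mult_ac)
  also have "\<dots> = (\<integral>\<^sup>+u. \<integral>\<^sup>+x. (indicator {0..} x * w x) * (indicator {0..} u * indicator {..1} (x + u) * g u) \<partial>lborel \<partial>lborel)"
    by (rule lborel_pair.Fubini'[symmetric]) measurable
  also have "\<dots> = (\<integral>\<^sup>+u. (indicator {0..} u * g u) * (\<integral>\<^sup>+x. indicator {0..1 - u} x * w x \<partial>lborel) \<partial>lborel)"
  proof (rule nn_integral_cong)
    fix u :: real
    have "(\<integral>\<^sup>+x. (indicator {0..} x * w x) * (indicator {0..} u * indicator {..1} (x + u) * g u) \<partial>lborel) =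
          (\<integral>\<^sup>+x. (indicator {0..} u * g u) * (indicator {0..1 - u} x * w x) \<partial>lborel)"
      by (intro nn_integral_cong) (auto simp: indicator_def mult_ac)
    also have "\<dots> = (indicator {0..} u * g u) * (\<integral>\<^sup>+x. indicator {0..1 - u} x * w x \<partial>lborel)"
      by (rule nn_integral_cmult) measurable
    finally show "(\<integral>\<^sup>+x. (indicator {0..} x * w x) * (indicator {0..} u * indicator {..1} (x + u) * g u) \<partial>lborel) =
          (indicator {0..} u * g u) * (\<integral>\<^sup>+x. indicator {0..1 - u} x * w x \<partial>lborel)" .
  qed
  also have "\<dots> = (\<integral>\<^sup>+u. indicator {0..1} u * g u * ennreal ((1 - u) ^ Suc c / fact (Suc c)) \<partial>lborel)"
  proof (rule nn_integral_cong)
    fix u :: real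
    show "(indicator {0..} u * g u) * (\<integral>\<^sup>+x. indicator {0..1 - u} x * w x \<partial>lborel) =
            indicator {0..1} u * g u * ennreal ((1 - u) ^ Suc c / fact (Suc c))"
    proof (cases "u \<le> 1")
      case True
      have "(\<integral>\<^sup>+x. indicator {0..1 - u} x * w x \<partial>lborel) = ennreal ((1 - u) ^ Suc c / fact (Suc c))"
        unfolding w_def by (rule nn_integral_power_fact_interval) (use True in simp)
      then show ?thesis using True by (simp add: indicator_def)
    next
      case False
      then have "\<And>x. indicator {0..1 - u} x * w x = 0" by (auto simp: indicator_def)
      then show ?thesis using False by (simp add: indicator_def)
    qed
  qed
  finally show ?thesis by (simp add: w_def)
qed

lemma nn_integral_orthant_block:
  fixes \<phi> :: "real \<Rightarrow> ennreal" and A B :: "nat set"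
  assumes AB: "A \<inter> B = {}" "finite A" "finite B" "B \<noteq> {}"
    and [measurable]: "\<phi> \<in> borel_measurable borel"
  shows "(\<integral>\<^sup>+t. orthant_indicator (A \<union> B) t * indicator {..1} (\<Sum>i\<in>A \<union> B. t i) * \<phi> (\<Sum>i\<in>B. t i)
            \<partial>Pi_lborel (A \<union> B)) =
    (\<integral>\<^sup>+u. indicator {0..1} u * \<phi> u * ennreal (u ^ (card B - 1) / fact (card B - 1)) *
        ennreal ((1 - u) ^ card A / fact (card A)) \<partial>lborel)"
proof -
  interpret product_sigma_finite "\<lambda>_. lborel :: real measure" by standard
  define g where "g = (\<lambda>u::real. \<phi> u * ennreal (u ^ (card B - 1) / fact (card B - 1)))"
  have [measurable]: "g \<in> borel_measurable borel" unfolding g_def by measurable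
  define \<Psi> where "\<Psi> = (\<lambda>w::real. \<integral>\<^sup>+u. indicator {0..} u * indicator {..1} (w + u) * g u \<partial>lborel)"
  have [measurable]: "\<Psi> \<in> borel_measurable borel" unfolding \<Psi>_def by measurable
  have "(\<integral>\<^sup>+t. orthant_indicator (A \<union> B) t * indicator {..1} (\<Sum>i\<in>A \<union> B. t i) * \<phi> (\<Sum>i\<in>B. t i)
            \<partial>Pi_lborel (A \<union> B)) =
    (\<integral>\<^sup>+x. \<integral>\<^sup>+y. orthant_indicator A x * (orthant_indicator B y *
          (indicator {..1} ((\<Sum>i\<in>A. x i) + (\<Sum>i\<in>B. y i)) * \<phi> (\<Sum>i\<in>B. y i))) \<partial>Pi_lborel B \<partial>Pi_lborel A)"
    using product_nn_integral_fold[OF AB(1-3)] AB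
    by (simp add: orthant_indicator_merge sum_merge mult_ac)
  also have "\<dots> = (\<integral>\<^sup>+x. orthant_indicator A x * \<Psi> (\<Sum>i\<in>A. x i) \<partial>Pi_lborel A)"
  proof (rule nn_integral_cong)
    fix x :: "nat \<Rightarrow> real"
    have inner: "(\<integral>\<^sup>+y. orthant_indicator B y * (indicator {..1} ((\<Sum>i\<in>A. x i) + (\<Sum>i\<in>B. y i)) * \<phi> (\<Sum>i\<in>B. y i))
             \<partial>Pi_lborel B) = \<Psi> (\<Sum>i\<in>A. x i)"
      using nn_integral_orthant_sum[OF AB(3), of "\<lambda>u. indicator {..1} ((\<Sum>i\<in>A. x i) + u) * \<phi> u"] AB(4)
      by (simp add: \<Psi>_def g_def mult_ac)
    have "(\<lambda>y. orthant_indicator B y * (indicator {..1} ((\<Sum>i\<in>A. x i) + (\<Sum>i\<in>B. y i)) * \<phi> (\<Sum>i\<in>B. y i)))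
            \<in> borel_measurable (Pi_lborel B)"
      using AB(3) by measurable
    from nn_integral_cmult[OF this, of "orthant_indicator A x"]
    show "(\<integral>\<^sup>+y. orthant_indicator A x * (orthant_indicator B y *
          (indicator {..1} ((\<Sum>i\<in>A. x i) + (\<Sum>i\<in>B. y i)) * \<phi> (\<Sum>i\<in>B. y i))) \<partial>Pi_lborel B) =
          orthant_indicator A x * \<Psi> (\<Sum>i\<in>A. x i)"
      unfolding inner .
  qed
  also have "\<dots> = (if A = {} then \<Psi> 0
                   else \<integral>\<^sup>+w. indicator {0..} w * \<Psi> w * ennreal (w ^ (card A - 1) / fact (card A - 1)) \<partial>lborel)"
    by (rule nn_integral_orthant_sum[OF AB(2)]) measurable
  also have "\<dots> = (\<integral>\<^sup>+u. indicator {0..1} u * g u * ennreal ((1 - u) ^ card A / fact (card A)) \<partial>lborel)"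
  proof (cases "A = {}")
    case True
    then show ?thesis
      by (simp add: \<Psi>_def, intro nn_integral_cong) (auto simp: indicator_def)
  next
    case False
    then have "card A = Suc (card A - 1)" using AB(2) by (simp add: card_gt_0_iff)
    then show ?thesis
      using False nn_integral_orthant_truncation[of g "card A - 1"] by (simp add: \<Psi>_def)
  qed
  finally show ?thesis by (simp add: g_def mult_ac)
qed

lemma simplex_std_sets: "simplex_std N \<in> sets (Pi_lborel {..<N})"
proof -
  have "simplex_std N = {t \<in> space (Pi_lborel {..<N}). (\<forall>j\<in>{..<N}. 0 \<le> t j) \<and> (\<Sum>j<N. t j) \<le> 1}"
    by (auto simp: simplex_std_def space_PiM PiE_def)
  also have "\<dots> \<in> sets (Pi_lborel {..<N})" by measurable
  finally show ?thesis .
qed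

lemma sum_block_in_unit_interval:
  assumes "t \<in> simplex_std N"
  shows "(\<Sum>j\<in>{k..<N}. t j) \<in> {0..1}"
proof -
  have nn: "\<And>j. j < N \<Longrightarrow> 0 \<le> t j" using assms by (auto simp: simplex_std_def)
  then have "0 \<le> (\<Sum>j\<in>{k..<N}. t j)" by (intro sum_nonneg) auto
  moreover have "(\<Sum>j\<in>{k..<N}. t j) \<le> (\<Sum>j<N. t j)" using nn by (intro sum_mono2) auto
  moreover have "(\<Sum>j<N. t j) \<le> 1" using assms by (auto simp: simplex_std_def)
  ultimately show ?thesis by auto
qed

lemma indicator_simplex_std:
  assumes "t \<in> space (Pi_lborel {..<N})"
  shows "(indicator (simplex_std N) t :: ennreal) = orthant_indicator {..<N} t * indicator {..1} (\<Sum>i<N. t i)"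
proof -
  have "orthant_indicator {..<N} t = (if \<forall>j<N. 0 \<le> t j then 1 else 0)"
    unfolding orthant_indicator_def by (induction N) (auto simp: indicator_def less_Suc_eq)
  then show ?thesis
    using assms by (auto simp: simplex_std_def indicator_def space_PiM PiE_def)
qed

lemma nn_integral_simplex_block_sum:
  fixes \<psi> :: "real \<Rightarrow> ennreal"
  assumes N: "N = k + m" "m \<ge> 1" and [measurable]: "\<psi> \<in> borel_measurable borel"
  shows "(\<integral>\<^sup>+t. indicator (simplex_std N) t * \<psi> (\<Sum>j\<in>{k..<N}. t j) \<partial>Pi_lborel {..<N}) =
           (\<integral>\<^sup>+u. indicator {0..1} u * \<psi> u * ennreal (u ^ (m - 1) / fact (m - 1)) *
                 ennreal ((1 - u) ^ k / fact k) \<partial>lborel)"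
proof -
  have AB: "{..<k} \<inter> {k..<N} = {}" "{k..<N} \<noteq> {}" "{..<k} \<union> {k..<N} = {..<N}"
    using N by auto
  have "(\<integral>\<^sup>+t. indicator (simplex_std N) t * \<psi> (\<Sum>j\<in>{k..<N}. t j) \<partial>Pi_lborel {..<N}) =
          (\<integral>\<^sup>+t. orthant_indicator ({..<k} \<union> {k..<N}) t * indicator {..1} (\<Sum>i\<in>{..<k} \<union> {k..<N}. t i) *
               \<psi> (\<Sum>j\<in>{k..<N}. t j) \<partial>Pi_lborel ({..<k} \<union> {k..<N}))"
    unfolding AB(3) by (intro nn_integral_cong) (simp add: indicator_simplex_std)
  also have "\<dots> = (\<integral>\<^sup>+u. indicator {0..1} u * \<psi> u * ennreal (u ^ (card {k..<N} - 1) / fact (card {k..<N} - 1)) *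
                       ennreal ((1 - u) ^ card {..<k} / fact (card {..<k})) \<partial>lborel)"
    by (rule nn_integral_orthant_block[OF AB(1) finite_lessThan finite_atLeastLessThan AB(2)]) measurable
  finally show ?thesis using N by simp
qed

lemma set_integral_simplex_block_sum:
  fixes \<phi> :: "real \<Rightarrow> real"
  assumes N: "N = k + m" "m \<ge> 1"
    and cont: "continuous_on {0..1} \<phi>" and nonneg: "\<And>u. u \<in> {0..1} \<Longrightarrow> \<phi> u \<ge> 0"
  shows "(\<integral>t\<in>simplex_std N. \<phi> (\<Sum>j\<in>{k..<N}. t j) \<partial>Pi_lborel {..<N}) =
     integral {0..1} (\<lambda>u. \<phi> u * (u ^ (m - 1) / fact (m - 1) * ((1 - u) ^ k / fact k)))"
proof -
  define \<psi> where "\<psi> = (\<lambda>u. \<phi> (max 0 (min 1 u)))"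
  have "continuous_on UNIV \<psi>"
    unfolding \<psi>_def by (rule continuous_on_compose2[OF cont]) (auto intro!: continuous_intros)
  then have [measurable]: "\<psi> \<in> borel_measurable borel"
    by (rule borel_measurable_continuous_onI)
  have \<psi>: "\<psi> u \<ge> 0" "u \<in> {0..1} \<Longrightarrow> \<psi> u = \<phi> u" for u
    using nonneg[of "max 0 (min 1 u)"] by (auto simp: \<psi>_def)
  define w where "w = (\<lambda>u::real. u ^ (m - 1) / fact (m - 1) * ((1 - u) ^ k / fact k))"
  have w: "continuous_on {0..1} w" "\<And>u. u \<in> {0..1} \<Longrightarrow> w u \<ge> 0"
    unfolding w_def by (auto intro!: continuous_intros)
  have int: "((\<lambda>u. \<phi> u * w u) has_integral integral {0..1} (\<lambda>u. \<phi> u * w u)) {0..1}"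
    using cont w by (intro integrable_integral integrable_continuous_interval continuous_on_mult)
  have "(\<integral>t\<in>simplex_std N. \<phi> (\<Sum>j\<in>{k..<N}. t j) \<partial>Pi_lborel {..<N}) =
          (\<integral>t. indicator (simplex_std N) t * \<psi> (\<Sum>j\<in>{k..<N}. t j) \<partial>Pi_lborel {..<N})"
    unfolding set_lebesgue_integral_def
    using sum_block_in_unit_interval \<psi> by (intro Bochner_Integration.integral_cong) (auto simp: indicator_def)
  also have "\<dots> = enn2real (\<integral>\<^sup>+t. indicator (simplex_std N) t * ennreal (\<psi> (\<Sum>j\<in>{k..<N}. t j)) \<partial>Pi_lborel {..<N})"
    using simplex_std_sets[of N] \<psi>(1)
    by (subst integral_eq_nn_integral) (measurable, simp_all add: indicator_mult_ennreal)
  also have "(\<integral>\<^sup>+t. indicator (simplex_std N) t * ennreal (\<psi> (\<Sum>j\<in>{k..<N}. t j)) \<partial>Pi_lborel {..<N}) =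
               (\<integral>\<^sup>+u. ennreal (indicator {0..1} u * (\<phi> u * w u)) \<partial>lborel)"
    unfolding nn_integral_simplex_block_sum[OF N measurable_compose[OF _ measurable_ennreal], of \<psi>, OF \<open>\<psi> \<in> _\<close>]
  proof (intro nn_integral_cong)
    fix u :: real
    show "indicator {0..1} u * ennreal (\<psi> u) * ennreal (u ^ (m - 1) / fact (m - 1)) *
            ennreal ((1 - u) ^ k / fact k) = ennreal (indicator {0..1} u * (\<phi> u * w u))"
      using nonneg \<psi>(2) by (cases "u \<in> {0..1}") (simp_all add: w_def ennreal_mult[symmetric] mult_ac)
  qed
  also have "\<dots> = ennreal (integral {0..1} (\<lambda>u. \<phi> u * w u))"
    by (rule nn_integral_has_integral_lebesgue[OF _ int]) (use nonneg w in auto)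
  moreover have "integral {0..1} (\<lambda>u. \<phi> u * w u) \<ge> 0"
    by (rule has_integral_nonneg[OF int]) (use nonneg w in auto)
  ultimately show ?thesis by (simp add: w_def)
qed

section \<open>Divided differences\<close>

lemma higher_deriv_ln:
  assumes "(y::real) > 0"
  shows "(deriv ^^ Suc n) ln y = (-1) ^ n * fact n / y ^ Suc n"
  using assms
proof (induction n arbitrary: y)
  case 0
  then show ?case using DERIV_ln_divide[OF 0] by (simp add: DERIV_imp_deriv)
next
  case (Suc n)
  have "1 + 1 * (y - 1) \<noteq> 0" using Suc.prems by simp
  from has_real_derivative_divide_denom_power[OF this, of "(-1) ^ n * fact n" "Suc n" UNIV]
  have "((\<lambda>y. (-1) ^ n * fact n / y ^ Suc n) has_real_derivative (-1) ^ Suc n * fact (Suc n) / y ^ Suc (Suc n)) (at y)"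
    by (simp add: algebra_simps)
  then have "((deriv ^^ Suc n) ln has_real_derivative (-1) ^ Suc n * fact (Suc n) / y ^ Suc (Suc n)) (at y)"
    by (rule has_field_derivative_transform_within_open[of _ _ _ "{0<..}"]) (use Suc in auto)
  then show ?case by (simp add: DERIV_imp_deriv del: funpow.simps) (simp add: DERIV_imp_deriv)
qed

text \<open>With nodes \<open>1\<close> (\<open>k + 1\<close> times) and \<open>s\<close> (\<open>l + 1\<close> times), the Hermite--Genocchi point is
  \<open>1 + (s - 1) (t\<^sub>k + \<dots> + t\<^sub>k\<^sub>+\<^sub>l)\<close>.\<close>

lemma divdiff_1s_eq_integral:
  fixes f g :: "real \<Rightarrow> real"
  assumes s: "s > 0"
    and g: "continuous_on {0<..} g" "\<And>y. y > 0 \<Longrightarrow> g y \<ge> 0"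
    and deriv_f: "\<And>y. y > 0 \<Longrightarrow> (deriv ^^ (k + l + 1)) f y = c * g y"
  shows "divdiff_1s (Suc k) s (Suc l) f =
           c * integral {0..1} (\<lambda>u. g (1 + u * (s - 1)) * (u ^ l / fact l * ((1 - u) ^ k / fact k)))"
proof -
  define N where "N = k + l + 1"
  define ys where "ys = replicate (Suc k) 1 @ replicate (Suc l) s"
  define \<phi> where "\<phi> = (\<lambda>u. g (1 + u * (s - 1)))"
  have split: "(\<Sum>j<N. h j) = (\<Sum>j<k. h j) + (\<Sum>j\<in>{k..<N}. h j)" for h :: "nat \<Rightarrow> real"
    by (simp add: lessThan_atLeast0 sum.atLeastLessThan_concat N_def)
  have ys: "ys ! 0 = 1" "\<And>j. j < N \<Longrightarrow> ys ! (j + 1) = (if j < k then 1 else s)"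
    by (auto simp: ys_def nth_append N_def nth_Cons')
  have point: "(1 - (\<Sum>j<N. t j)) * ys ! 0 + (\<Sum>j<N. t j * ys ! (j + 1)) = 1 + (\<Sum>j\<in>{k..<N}. t j) * (s - 1)" for t
  proof -
    have "(\<Sum>j<k. t j * ys ! (j + 1)) = (\<Sum>j<k. t j)" using ys by (intro sum.cong) (auto simp: N_def)
    moreover have "(\<Sum>j\<in>{k..<N}. t j * ys ! (j + 1)) = s * (\<Sum>j\<in>{k..<N}. t j)"
      using ys by (simp add: sum_distrib_left mult.commute)
    ultimately show ?thesis
      unfolding split[of t] split[of "\<lambda>j. t j * ys ! (j + 1)"] ys(1) by (simp add: algebra_simps)
  qed
  have pos: "u \<in> {0..1} \<Longrightarrow> 1 + u * (s - 1) > 0" for u using euler_denom_pos[OF s] by auto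
  have \<phi>: "continuous_on {0..1} \<phi>" "\<And>u. u \<in> {0..1} \<Longrightarrow> \<phi> u \<ge> 0"
    unfolding \<phi>_def using pos g by (auto intro!: continuous_on_compose2[OF g(1)] continuous_intros)
  have "divdiff_1s (Suc k) s (Suc l) f =
      (\<integral>t\<in>simplex_std N. (deriv ^^ N) f ((1 - (\<Sum>j<N. t j)) * ys ! 0 + (\<Sum>j<N. t j * ys ! (j + 1)))
         \<partial>Pi_lborel {..<N})"
    unfolding divdiff_1s_def divdiff_def Let_def ys_def[symmetric] by (simp add: ys_def N_def)
  also have "\<dots> = (\<integral>t\<in>simplex_std N. c * \<phi> (\<Sum>j\<in>{k..<N}. t j) \<partial>Pi_lborel {..<N})"
  proof (intro set_lebesgue_integral_cong[OF simplex_std_sets] allI impI)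
    fix t assume "t \<in> simplex_std N"
    then have "1 + (\<Sum>j\<in>{k..<N}. t j) * (s - 1) > 0" using pos sum_block_in_unit_interval by blast
    then show "(deriv ^^ N) f ((1 - (\<Sum>j<N. t j)) * ys ! 0 + (\<Sum>j<N. t j * ys ! (j + 1))) =
               c * \<phi> (\<Sum>j\<in>{k..<N}. t j)"
      unfolding point \<phi>_def by (rule deriv_f[folded N_def])
  qed
  also have "\<dots> = c * integral {0..1} (\<lambda>u. \<phi> u * (u ^ l / fact l * ((1 - u) ^ k / fact k)))"
    using set_integral_simplex_block_sum[of N k "Suc l" \<phi>] \<phi> by (simp add: N_def)
  finally show ?thesis by (simp add: \<phi>_def)
qed

lemma frakH_0_eq_divdiff_ln:
  assumes s: "s > 0"
  shows "frakH a0 a1 s 0 = (-1) ^ (a0 + a1) * divdiff_1s (a0 + 1) s (a1 + 1) ln"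
proof -
  define n where "n = a0 + a1"
  have "divdiff_1s (Suc a0) s (Suc a1) ln =
          (-1) ^ n * integral {0..1} (\<lambda>u. fact n / (1 + u * (s - 1)) ^ (n + 1) * (u ^ a1 / fact a1 * ((1 - u) ^ a0 / fact a0)))"
    using s higher_deriv_ln[of _ n]
    by (intro divdiff_1s_eq_integral) (auto simp: n_def intro!: continuous_intros)
  also have "\<dots> = (-1) ^ n * (fact n / (fact a0 * fact a1) * euler_int (n + 1) a1 a0 s)"
    unfolding euler_int_def integral_cmult_real[symmetric] by (simp add: field_simps)
  finally show ?thesis
    using frakH_0_eq_euler_int[OF s, of a0 a1] by (simp add: n_def flip: power_add)
qed

lemma divdiff_1s_0_eq_higher_deriv:
  "divdiff_1s 0 s (Suc l) f = (deriv ^^ l) f s / fact l"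
proof -
  define c where "c = (deriv ^^ l) f s"
  define ys where "ys = replicate 0 1 @ replicate (Suc l) s"
  have ys: "\<And>i. i < Suc l \<Longrightarrow> ys ! i = s" by (simp add: ys_def nth_Cons')
  have "(1 - (\<Sum>j<l. t j)) * ys ! 0 + (\<Sum>j<l. t j * ys ! (j + 1)) = s" for t
  proof -
    have "(\<Sum>j<l. t j * ys ! (j + 1)) = (\<Sum>j<l. t j) * s" by (simp add: ys sum_distrib_right)
    then show ?thesis by (simp add: ys algebra_simps)
  qed
  then have "divdiff_1s 0 s (Suc l) f = (\<integral>t\<in>simplex_std l. c * 1 \<partial>Pi_lborel {..<l})"
    unfolding divdiff_1s_def divdiff_def Let_def ys_def[symmetric] by (simp add: ys_def c_def)
  also have "\<dots> = c / fact l"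
  proof (cases "l = 0")
    case True
    have "simplex_std 0 = {\<lambda>_. undefined}" by (auto simp: simplex_std_def)
    then show ?thesis
      using True by (simp add: PiM_empty set_lebesgue_integral_def lebesgue_integral_count_space_finite)
  next
    case False
    have "integral {0..1} (\<lambda>u::real. 1 * (u ^ (l - 1) / fact (l - 1) * ((1 - u) ^ 0 / fact 0))) = 1 / fact l"
      using integral_unique[OF power_fact_has_integral[of 1 "l - 1"]] False by simp
    then show ?thesis
      using set_integral_simplex_block_sum[of l 0 l "\<lambda>_. 1"] False
      by (subst set_integral_mult_right) simp
  qed
  finally show ?thesis by (simp add: c_def)
qed

lemma higher_deriv_L0:
  assumes "y > 0"
  shows "(deriv ^^ n) L0 y = (-1) ^ n * fact n * euler_int (n + 1) n 0 y"
proof -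
  have "(deriv ^^ n) L0 y = (deriv ^^ n) (euler_int 1 0 0) y"
    by (rule higher_deriv_cong_open[of "{0<..}"]) (use assms euler_int_1_0_0 in auto)
  then show ?thesis
    using higher_deriv_euler_int[OF assms, of n 1 0 0] by (simp add: pochhammer_fact add.commute)
qed

lemma has_real_derivative_ibp_primitive:
  fixes s u :: real
  assumes s: "s > 0" and u: "u \<in> {0..1}" and n: "n = Suc k + a1"
  defines "Q \<equiv> \<lambda>u. euler_int (n + 1) n 0 (1 + u * (s - 1))"
  shows "((\<lambda>u. (1 - u) ^ Suc k * u ^ (a1 + 1) * Q u) has_real_derivative
           - real (Suc k) * ((1 - u) ^ k * u ^ a1 * Q u) + (1 - u) ^ Suc k * u ^ a1 / (1 + u * (s - 1)) ^ (n + 1))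
         (at u)"
proof -
  define y where "y = 1 + u * (s - 1)"
  have Y: "y > 0" using euler_denom_pos[OF s u] by (simp add: y_def)
  define J2 where "J2 = euler_int (n + 2) (n + 1) 0 y"
  have "((\<lambda>u. 1 + u * (s - 1)) has_real_derivative (s - 1)) (at u)"
    by (rule derivative_eq_intros refl)+ simp
  from DERIV_chain2[OF euler_int_has_real_derivative[OF Y, of "n + 1" n 0, unfolded y_def] this]
  have dQ: "(Q has_real_derivative (- real (n + 1) * J2) * (s - 1)) (at u)"
    by (simp add: Q_def J2_def y_def)
  have "((\<lambda>u. (1 - u) ^ Suc k * u ^ (a1 + 1) * Q u) has_real_derivative
       ((- real (Suc k) * (1 - u) ^ k) * u ^ (a1 + 1) + (real (a1 + 1) * u ^ a1) * (1 - u) ^ Suc k) * Q u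
        + ((- real (n + 1) * J2) * (s - 1)) * ((1 - u) ^ Suc k * u ^ (a1 + 1))) (at u)"
    by (intro DERIV_mult dQ) (rule derivative_eq_intros refl | simp add: algebra_simps)+
  moreover
  define A where "A = (1 - u) ^ k * u ^ a1"
  define R where "R = 1 / y ^ (n + 1)"
  have rel: "(u * (s - 1)) * J2 = Q u - R / real (n + 1)"
    using euler_int_diagonal_step[OF Y, of n] by (simp add: Q_def J2_def y_def R_def)
  have "((- real (Suc k) * (1 - u) ^ k) * u ^ (a1 + 1) + (real (a1 + 1) * u ^ a1) * (1 - u) ^ Suc k) * Q u
        + ((- real (n + 1) * J2) * (s - 1)) * ((1 - u) ^ Suc k * u ^ (a1 + 1))
      = A * ((- real (Suc k) * u + real (a1 + 1) * (1 - u)) * Q u - real (n + 1) * (1 - u) * ((u * (s - 1)) * J2))"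
    by (simp add: A_def algebra_simps)
  also have "\<dots> = A * ((- real (Suc k) * u + real (a1 + 1) * (1 - u) - real (n + 1) * (1 - u)) * Q u + (1 - u) * R)"
    unfolding rel by (simp add: algebra_simps) (simp add: field_simps)
  also have "- real (Suc k) * u + real (a1 + 1) * (1 - u) - real (n + 1) * (1 - u) = - real (Suc k)"
    using n by (simp add: algebra_simps)
  finally show ?thesis
    by (simp add: A_def R_def y_def algebra_simps)
qed

lemma integral_euler_int_beta:
  assumes s: "s > 0" and n: "n = Suc k + a1"
  shows "integral {0..1} (\<lambda>u. euler_int (n + 1) n 0 (1 + u * (s - 1)) * (u ^ a1 * (1 - u) ^ k))
           = euler_int (n + 1) a1 (Suc k) s / real (Suc k)"
proof -
  define Q where "Q = (\<lambda>u. euler_int (n + 1) n 0 (1 + u * (s - 1)))"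
  define P where "P = (\<lambda>u::real. (1 - u) ^ Suc k * u ^ (a1 + 1) * Q u)"
  have Q: "continuous_on {0..1} Q"
    unfolding Q_def using euler_denom_pos[OF s]
    by (intro continuous_on_compose2[OF continuous_on_euler_int] continuous_intros) auto
  have int1: "(\<lambda>u. - real (Suc k) * ((1 - u) ^ k * u ^ a1 * Q u)) integrable_on {0..1}"
    by (intro integrable_continuous_interval continuous_intros Q)
  have int2: "(\<lambda>u. (1 - u) ^ Suc k * u ^ a1 / (1 + u * (s - 1)) ^ (n + 1)) integrable_on {0..1}"
    by (intro integrable_continuous_interval continuous_intros) (use euler_denom_pos[OF s] in fastforce)
  define P' where "P' = (\<lambda>u. - real (Suc k) * ((1 - u) ^ k * u ^ a1 * Q u)
                               + (1 - u) ^ Suc k * u ^ a1 / (1 + u * (s - 1)) ^ (n + 1))"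
  have "(P' has_integral (P 1 - P 0)) {0..1}"
    unfolding P_def P'_def Q_def using has_real_derivative_ibp_primitive[OF s _ n]
    by (intro fundamental_theorem_of_calculus)
       (auto simp: has_real_derivative_iff_has_vector_derivative[symmetric] intro: has_field_derivative_at_within)
  moreover have "P 1 - P 0 = 0" by (simp add: P_def)
  moreover have "integral {0..1} P' = - real (Suc k) * integral {0..1} (\<lambda>u. (1 - u) ^ k * u ^ a1 * Q u)
        + integral {0..1} (\<lambda>u. (1 - u) ^ Suc k * u ^ a1 / (1 + u * (s - 1)) ^ (n + 1))"
    unfolding P'_def integral_add[OF int1 int2] by (simp only: integral_cmult_real)
  ultimately have "- real (Suc k) * integral {0..1} (\<lambda>u. (1 - u) ^ k * u ^ a1 * Q u)
        + integral {0..1} (\<lambda>u. (1 - u) ^ Suc k * u ^ a1 / (1 + u * (s - 1)) ^ (n + 1)) = 0"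
    by (simp add: integral_unique)
  moreover have "integral {0..1} (\<lambda>u. (1 - u) ^ Suc k * u ^ a1 / (1 + u * (s - 1)) ^ (n + 1))
                   = euler_int (n + 1) a1 (Suc k) s"
    unfolding euler_int_def by (rule integral_cong) (simp add: mult_ac)
  moreover have "integral {0..1} (\<lambda>u. euler_int (n + 1) n 0 (1 + u * (s - 1)) * (u ^ a1 * (1 - u) ^ k)) =
                   integral {0..1} (\<lambda>u. (1 - u) ^ k * u ^ a1 * Q u)"
    unfolding Q_def by (rule integral_cong) (simp add: mult_ac)
  ultimately show ?thesis
    by (simp add: field_simps)
qed

lemma frakH_0_eq_divdiff_L0:
  assumes s: "s > 0"
  shows "frakH a0 a1 s 0 = (-1) ^ (a0 + a1) * divdiff_1s a0 s (a1 + 1) L0"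
proof (cases a0)
  case 0
  have "Lm 0 = L0" by (simp add: Lm_def L0_def fun_eq_iff)
  then show ?thesis
    using 0 frakH_0_eq_higher_deriv[OF s, of 0 a1] divdiff_1s_0_eq_higher_deriv[of s a1 L0] by simp
next
  case (Suc k)
  define n where "n = Suc k + a1"
  have "divdiff_1s (Suc k) s (Suc a1) L0 =
          (-1) ^ n * integral {0..1} (\<lambda>u. fact n * euler_int (n + 1) n 0 (1 + u * (s - 1)) *
                                       (u ^ a1 / fact a1 * ((1 - u) ^ k / fact k)))"
    using s higher_deriv_L0[of _ n] euler_int_nonneg continuous_on_euler_int
    by (intro divdiff_1s_eq_integral) (auto simp: n_def intro!: continuous_intros)
  also have "\<dots> = (-1) ^ n * (fact n / (fact a1 * fact k) * (euler_int (n + 1) a1 (Suc k) s / real (Suc k)))"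
    unfolding integral_euler_int_beta[OF s n_def, symmetric] integral_cmult_real[symmetric]
    by (simp add: field_simps)
  finally have "divdiff_1s (Suc k) s (Suc a1) L0 =
                  (-1) ^ n * (fact n / (fact a1 * fact k) * (euler_int (n + 1) a1 (Suc k) s / real (Suc k)))" .
  moreover have "frakH (Suc k) a1 s 0 = fact n / (fact (Suc k) * fact a1) * euler_int (n + 1) a1 (Suc k) s"
    using frakH_0_eq_euler_int[OF s, of "Suc k" a1] by (simp add: n_def)
  moreover have "(-1::real) ^ n * (-1) ^ n = 1" by (simp flip: power_add)
  ultimately show ?thesis
    unfolding Suc n_def[symmetric] fact_Suc by (simp add: field_simps)
qed

theorem mainTheorem14:
  fixes a0 a1 :: nat and s :: real
  assumes "s > 0"
  shows "(\<forall>m\<le>a1.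
            frakH a0 a1 s m =
              (-1) ^ (a1 + m) / (fact a0 * fact a1) * (1 / s ^ (a1 - m)) *
              (deriv ^^ a0) (\<lambda>t. t ^ (a0 + a1 - m) * (deriv ^^ a1) (Lm m) t) s
          \<and> frakH a0 a1 s m =
              (-1) ^ (a1 + m) / (fact a0 * fact a1) *
              (deriv ^^ a1) (\<lambda>t. t ^ m * (deriv ^^ a0) (Lm a0) t) s)
       \<and> frakH a0 a1 s 0 = (-1) ^ (a0 + a1) * divdiff_1s (a0 + 1) s (a1 + 1) ln
       \<and> frakH a0 a1 s 0 = (-1) ^ (a0 + a1) * divdiff_1s a0 s (a1 + 1) L0
       \<and> frakH a0 a1 s 0 = (-1) ^ a1 / (fact a0 * fact a1) * (deriv ^^ (a0 + a1)) (Lm a0) s"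
  using frakH_eq_higher_deriv_Lm_m[OF assms] frakH_eq_higher_deriv_Lm_a0[OF assms]
    frakH_0_eq_divdiff_ln[OF assms] frakH_0_eq_divdiff_L0[OF assms] frakH_0_eq_higher_deriv[OF assms]
  by blast

end
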